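(* Let $G$ be a finite simple graph with $n$ vertices, and let $k$ be a nonnegative real number. Then the number of maximal independent sets $I\subseteq V(G)$ with $|I|\le k$ is at most $3^{4k-n}4^{n-3k}$.
   Context: An independent set of $G$ is a set of pairwise nonadjacent vertices; it is maximal if it is not properly contained in another independent set of $G$. *)

theory Defs
  imports Complex_Main "Graph_Theory.Pair_Digraph"
begin

text \<open>
  Finite simple graphs are modelled by \<^locale>\<open>pair_graph\<close>: finite loopfree digraphs whose arcs
  form a symmetric relation, so an undirected edge between u and v is the pair of arcs
  (u, v) and (v, u).
\<close>

definition independent_set :: "'a pair_pre_digraph \<Rightarrow> 'a set \<Rightarrow> bool" where
  "independent_set G I \<longleftrightarrow> I \<subseteq> pverts G \<and> (\<forall>u\<in>I. \<forall>v\<in>I. (u, v) \<notin> parcs G)"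

definition maximal_independent_set :: "'a pair_pre_digraph \<Rightarrow> 'a set \<Rightarrow> bool" where
  "maximal_independent_set G I \<longleftrightarrow>
     independent_set G I \<and> \<not> (\<exists>J. independent_set G J \<and> I \<subset> J)"

end

theory Submission
  imports Defs
begin

text \<open>
  Branch on the closed neighbourhood of a vertex v of minimum degree: every maximal independent
  set contains some u in N[v], and removing N[u] leaves a maximal independent set of the remaining
  graph with one vertex less. Writing the bound as (4/3)^n (81/64)^k, each branch contributes a
  factor at most (64/81) (3/4)^d, where d = |N[v]| is also the number of branches; so the induction
  closes because d (3/4)^d \<le> 81/64 for all d, with equality at d = 3 and d = 4.
\<close>

text \<open>The ratio of consecutive values is (3/4)(d + 1)/d, which is at most 1 exactly when d
  \<ge> 3. So the values never increase from 4 on, and the smaller d are checked one by one.\<close>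

lemma mult_three_quarters_power_le: "real d * (3/4)^d \<le> 81/64"
proof (cases "d \<le> 3")
  case True
  then have "d \<in> {0, 1, 2, 3}" by auto
  then show ?thesis by (auto simp: power_numeral_reduce)
next
  case False
  then have "4 \<le> d" by simp
  then show ?thesis
  proof (induction d rule: dec_induct)
    case base
    show ?case by (simp add: power_numeral_reduce)
  next
    case (step m)
    have "real (Suc m) * (3/4) \<le> real m" using step.hyps by simp
    then have "real (Suc m) * (3/4) * (3/4)^m \<le> real m * (3/4)^m"
      by (intro mult_right_mono) auto
    with step.IH have "real (Suc m) * (3/4) * (3/4)^m \<le> 81/64" by (rule order_trans[rotated])
    then show ?case by (simp only: power_Suc mult.assoc)
  qed
qed

definition closed_neighbourhood :: "'a rel \<Rightarrow> 'a set \<Rightarrow> 'a \<Rightarrow> 'a set" where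
  "closed_neighbourhood R S u = {w \<in> S. w = u \<or> (u, w) \<in> R}"

text \<open>Fixing \<open>R\<close> and shrinking only \<open>S\<close> expresses passage to induced
  subgraphs. Maximality appears as domination, a local condition that is easy to transfer when
  vertices are deleted.\<close>

definition mis_on :: "'a rel \<Rightarrow> 'a set \<Rightarrow> 'a set \<Rightarrow> bool" where
  "mis_on R S I \<longleftrightarrow> I \<subseteq> S \<and> (\<forall>u\<in>I. \<forall>w\<in>I. (u, w) \<notin> R) \<and> (\<forall>u\<in>S - I. \<exists>w\<in>I. (u, w) \<in> R)"

lemma closed_neighbourhood_subset: "closed_neighbourhood R S u \<subseteq> S"
  by (auto simp: closed_neighbourhood_def)

text \<open>A vertex outside the closed neighbourhood of \<open>u\<close> is not dominated by
  \<open>u\<close>, so the neighbour that dominates it survives the removal. By independence no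
  other member of \<open>I\<close> is deleted.\<close>

lemma mis_on_Diff_closed_neighbourhood:
  assumes "sym R" "mis_on R S I" "u \<in> I"
  shows "mis_on R (S - closed_neighbourhood R S u) (I - {u})"
proof -
  have I: "I \<subseteq> S" "\<forall>u\<in>I. \<forall>w\<in>I. (u, w) \<notin> R" "\<forall>u\<in>S - I. \<exists>w\<in>I. (u, w) \<in> R"
    using assms(2) by (simp_all add: mis_on_def)
  have "\<exists>w\<in>I - {u}. (x, w) \<in> R" if x: "x \<in> S" "x \<noteq> u" "(u, x) \<notin> R" "x \<notin> I" for x
  proof -
    obtain w where w: "w \<in> I" "(x, w) \<in> R" using I(3) x by blast
    then have "w \<noteq> u" using x(3) assms(1) by (auto dest: symD)
    with w show ?thesis by blast
  qed
  moreover have "I - {u} \<subseteq> S - closed_neighbourhood R S u"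
    using I(1,2) assms(3) by (auto simp: closed_neighbourhood_def)
  ultimately show ?thesis
    using I(2) by (auto simp: mis_on_def closed_neighbourhood_def)
qed

text \<open>Either \<open>v\<close> lies in \<open>I\<close>, or a neighbour of \<open>v\<close> in
  \<open>I\<close> dominates it.\<close>

lemma mis_on_meets_closed_neighbourhood:
  assumes "mis_on R S I" "v \<in> S"
  shows "\<exists>u \<in> closed_neighbourhood R S v. u \<in> I"
  using assms unfolding mis_on_def closed_neighbourhood_def by blast

lemma card_mis_on_le:
  assumes "sym R" "finite S"
  shows "real (card {I. mis_on R S I \<and> real (card I) \<le> k}) \<le> (4/3)^card S * (81/64) powr k"
  using assms(2)
proof (induction "card S" arbitrary: S k rule: less_induct)
  case less
  let ?N = "closed_neighbourhood R S"
  let ?M = "\<lambda>S k. {I. mis_on R S I \<and> real (card I) \<le> k}"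
  have finM: "finite (?M T k)" if "T \<subseteq> S" for T k
    by (rule finite_subset[of _ "Pow S"]) (use that less.prems in \<open>auto simp: mis_on_def\<close>)
  show ?case
  proof (cases "S = {}")
    case True
    \<comment> \<open>The recursion lowers \<open>k\<close> by 1, so it may be negative here: then
      even the empty set is too large and the count is 0. Otherwise only the empty set counts, and
      the bound is at least 1.\<close>
    show ?thesis
    proof (cases "k \<ge> 0")
      case k: True
      have "?M S k \<subseteq> {{}}" using True by (auto simp: mis_on_def)
      then have "card (?M S k) \<le> card {{} :: 'a set}" by (intro card_mono) auto
      moreover have "(81/64 :: real) powr k \<ge> 1" using k by (simp add: ge_one_powr_ge_zero)
      ultimately show ?thesis using True by simp
    next
      case k: False
      then have "?M S k = {}" using True by (auto simp: mis_on_def)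
      then show ?thesis by (simp only: card.empty) simp
    qed
  next
    case False
    obtain v where v: "v \<in> S" and vmin: "\<And>u. u \<in> S \<Longrightarrow> card (?N v) \<le> card (?N u)"
      using ex_is_arg_min_if_finite[OF less.prems False, of "\<lambda>u. card (?N u)"]
      by (auto simp: is_arg_min_linorder)
    define d where "d = card (?N v)"
    have finN: "finite (?N u)" for u
      using closed_neighbourhood_subset less.prems by (rule finite_subset)
    \<comment> \<open>The union may overlap, since \<open>I\<close> can contain several vertices of
      \<open>?N v\<close>; overcounting is harmless for an upper bound.\<close>
    have cover: "?M S k \<subseteq> (\<Union>u\<in>?N v. insert u ` ?M (S - ?N u) (k - 1))"
    proof
      fix I assume "I \<in> ?M S k"
      then have I: "mis_on R S I" "real (card I) \<le> k" by simp_all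
      obtain u where u: "u \<in> ?N v" "u \<in> I"
        using mis_on_meets_closed_neighbourhood[OF I(1) v] by (elim bexE)
      have "I \<subseteq> S" using I(1) by (simp add: mis_on_def)
      then have "finite I" using less.prems by (rule finite_subset)
      then have "card I = Suc (card (I - {u}))" using u by (metis card.remove)
      then have "I - {u} \<in> ?M (S - ?N u) (k - 1)"
        using I(2) mis_on_Diff_closed_neighbourhood[OF assms(1) I(1) u(2)] by simp
      moreover have "I = insert u (I - {u})" using u by auto
      ultimately show "I \<in> (\<Union>u\<in>?N v. insert u ` ?M (S - ?N u) (k - 1))"
        using u(1) by blast
    qed
    have branch: "real (card (?M (S - ?N u) (k - 1)))
        \<le> (4/3)^card S * (81/64) powr k * ((64/81) * (3/4)^d)" if "u \<in> ?N v" for u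
    proof -
      have u: "u \<in> S" using that by (simp add: closed_neighbourhood_def)
      then have "u \<in> ?N u" by (simp add: closed_neighbourhood_def)
      have le: "card (?N u) \<le> card S"
        using closed_neighbourhood_subset less.prems by (intro card_mono)
      have card: "card (S - ?N u) = card S - card (?N u)"
        by (rule card_Diff_subset[OF finN closed_neighbourhood_subset])
      have "S - ?N u \<subset> S" using u \<open>u \<in> ?N u\<close> by blast
      then have "card (S - ?N u) < card S" using less.prems by (rule psubset_card_mono[rotated])
      then have "real (card (?M (S - ?N u) (k - 1))) \<le> (4/3)^card (S - ?N u) * (81/64) powr (k - 1)"
        using less.prems by (intro less.hyps) auto
      also have "(4/3 :: real)^card (S - ?N u) = (4/3)^card S * (3/4)^card (?N u)"
        using le by (simp add: card power_diff power_divide)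
      also have "(81/64 :: real) powr (k - 1) = (81/64) powr k * (64/81)"
        by (simp add: powr_diff)
      also have "(4/3)^card S * (3/4)^card (?N u) * ((81/64) powr k * (64/81))
          = (4/3)^card S * (81/64) powr k * ((64/81) * (3/4 :: real)^card (?N u))"
        by simp
      \<comment> \<open>Here the choice of \<open>v\<close> enters: every branch deletes at least
        \<open>d\<close> vertices, and powers of 3/4 decrease.\<close>
      also have "\<dots> \<le> (4/3)^card S * (81/64) powr k * ((64/81) * (3/4)^d)"
        using vmin[OF u] by (intro mult_left_mono power_decreasing) (auto simp: d_def)
      finally show ?thesis .
    qed
    have "card (?M S k) \<le> card (\<Union>u\<in>?N v. insert u ` ?M (S - ?N u) (k - 1))"
      by (intro card_mono[OF _ cover] finite_UN_I finN finite_imageI finM) auto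
    also have "\<dots> \<le> (\<Sum>u\<in>?N v. card (insert u ` ?M (S - ?N u) (k - 1)))"
      by (rule card_UN_le[OF finN])
    also have "\<dots> \<le> (\<Sum>u\<in>?N v. card (?M (S - ?N u) (k - 1)))"
      by (intro sum_mono card_image_le finM) auto
    finally have "real (card (?M S k)) \<le> (\<Sum>u\<in>?N v. real (card (?M (S - ?N u) (k - 1))))"
      by (simp only: of_nat_sum[symmetric] of_nat_le_iff)
    also have "\<dots> \<le> (\<Sum>u\<in>?N v. (4/3)^card S * (81/64) powr k * ((64/81) * (3/4)^d))"
      by (intro sum_mono branch)
    \<comment> \<open>The factor \<open>real d\<close> counts the branches, one for each vertex of
      \<open>?N v\<close>.\<close>
    also have "\<dots> = (4/3)^card S * (81/64) powr k * ((64/81) * (real d * (3/4)^d))"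
      by (simp add: d_def)
    also have "\<dots> \<le> (4/3)^card S * (81/64) powr k * 1"
      using mult_three_quarters_power_le[of d] by (intro mult_left_mono) auto
    finally show ?thesis by simp
  qed
qed

text \<open>An undominated vertex outside \<open>I\<close> could be added to \<open>I\<close>,
  against maximality: symmetry excludes arcs in both directions, and looplessness excludes the arc
  from the vertex to itself.\<close>

lemma maximal_independent_set_imp_mis_on:
  assumes "pair_graph G" "maximal_independent_set G I"
  shows "mis_on (parcs G) (pverts G) I"
proof -
  interpret pair_graph G by fact
  have sym: "(a, b) \<in> parcs G \<Longrightarrow> (b, a) \<in> parcs G" for a b
    by (rule arcs_symmetric)
  have I: "I \<subseteq> pverts G" "\<forall>u\<in>I. \<forall>w\<in>I. (u, w) \<notin> parcs G"
    using assms(2) by (auto simp: maximal_independent_set_def independent_set_def)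
  have "\<exists>w\<in>I. (u, w) \<in> parcs G" if u: "u \<in> pverts G - I" for u
  proof (rule ccontr)
    assume "\<not> ?thesis"
    moreover have "(u, u) \<notin> parcs G" using no_loops by force
    ultimately have "independent_set G (insert u I)"
      using I u sym by (auto simp: independent_set_def)
    moreover have "I \<subset> insert u I" using u by auto
    ultimately show False using assms(2) by (auto simp: maximal_independent_set_def)
  qed
  with I show ?thesis by (auto simp: mis_on_def)
qed

theorem theorem1:
  fixes G :: "'a pair_pre_digraph" and n :: nat and k :: real
  assumes "pair_graph G"
    and "card (pverts G) = n"
    and "k \<ge> 0"
  shows "real (card {I. maximal_independent_set G I \<and> real (card I) \<le> k})
           \<le> 3 powr (4 * k - real n) * 4 powr (real n - 3 * k)"
proof -
  interpret pair_graph G by fact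
  let ?M = "{I. mis_on (parcs G) (pverts G) I \<and> real (card I) \<le> k}"
  have "sym (parcs G)" by (rule symI) (rule arcs_symmetric)
  have "finite ?M"
    by (rule finite_subset[of _ "Pow (pverts G)"]) (auto simp: mis_on_def)
  then have "real (card {I. maximal_independent_set G I \<and> real (card I) \<le> k}) \<le> real (card ?M)"
    using maximal_independent_set_imp_mis_on[OF assms(1)] by (intro of_nat_mono card_mono) auto
  also have "real (card ?M) \<le> (4/3)^n * (81/64) powr k"
    using card_mis_on_le[OF \<open>sym (parcs G)\<close>, of "pverts G" k] assms(2) by simp
  also have "\<dots> = 3 powr (4 * k - real n) * 4 powr (real n - 3 * k)"
  proof -
    \<comment> \<open>Since 81 = 3^4 and 64 = 4^3, collecting the exponents of 3 and 4 turns the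
      inductive bound into the stated one.\<close>
    have "3 powr (4 * k) = (81 :: real) powr k" "4 powr (3 * k) = (64 :: real) powr k"
      using powr_powr[of "3::real" 4 k] powr_powr[of "4::real" 3 k] by simp_all
    then show ?thesis
      by (simp add: powr_diff powr_realpow powr_divide power_divide)
  qed
  finally show ?thesis .
qed

end
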